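(* Let $G$ be a simple connected graph with vertices $v_1,\dots,v_n$ and adjacency matrix $\mathbf{A}=\mathbf{A}(G)=(a_{i,j})$. Let $v_\ell$ and $v_k$ ($\ell\neq k$) be twin vertices of $G$, and let $h_{\ell,k}=h_{\ell,k}(\lambda)$ denote the entry in row $\ell$ and column $k$ of $\operatorname{adj}(\lambda\mathbf{I}-\mathbf{A})$. Then, as an identity of rational functions in $\lambda$, $$\phi(\mathbf{A}(G_{-v_\ell}),\lambda)=\frac{\phi(\mathbf{A}(G),\lambda)}{\lambda+a_{\ell,k}}+h_{\ell,k}.$$
   Context: The adjacency matrix has $a_{i,j}=1$ if $v_i,v_j$ are adjacent and $a_{i,j}=0$ otherwise. Two distinct vertices are twins if they are duplicates (non-adjacent with the same neighbours) or co-duplicates (adjacent, and duplicate vertices in the complement of $G$, i.e. with the same neighbours among the remaining vertices). For a square matrix $\mathbf{M}$, $\phi(\mathbf{M},\lambda)=\det(\lambda\mathbf{I}-\mathbf{M})$ is its characteristic polynomial, and $\operatorname{adj}$ denotes the adjugate matrix. $G_{-v}$ is the graph obtained from $G$ by deleting vertex $v$ and its incident edges. *)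

theory Defs
  imports
    "HOL-Computational_Algebra.Polynomial_Factorial"
    "Jordan_Normal_Form.Char_Poly"
    "Graph_Theory.Digraph_Component"
begin

text \<open>
  A finite simple graph is a member of the locale \<^locale>\<open>graph\<close>: a finite loop-free symmetric
  digraph without parallel arcs. An undirected edge is a pair of opposite arcs, so adjacency of
  two vertices is the relation \<^const>\<open>dominates\<close>.
\<close>

definition complement_graph :: "('a, 'b) pre_digraph \<Rightarrow> 'a pair_pre_digraph" where
  "complement_graph G =
    \<lparr>pverts = verts G,
     parcs = {(u, v). u \<in> verts G \<and> v \<in> verts G \<and> u \<noteq> v \<and> \<not> u \<rightarrow>\<^bsub>G\<^esub> v}\<rparr>"

definition duplicates :: "('a, 'b) pre_digraph \<Rightarrow> 'a \<Rightarrow> 'a \<Rightarrow> bool" where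
  "duplicates G u v \<longleftrightarrow>
    u \<in> verts G \<and> v \<in> verts G \<and> u \<noteq> v \<and> \<not> u \<rightarrow>\<^bsub>G\<^esub> v \<and>
    {w. u \<rightarrow>\<^bsub>G\<^esub> w} = {w. v \<rightarrow>\<^bsub>G\<^esub> w}"

definition co_duplicates :: "('a, 'b) pre_digraph \<Rightarrow> 'a \<Rightarrow> 'a \<Rightarrow> bool" where
  "co_duplicates G u v \<longleftrightarrow>
    u \<rightarrow>\<^bsub>G\<^esub> v \<and> duplicates (with_proj (complement_graph G)) u v"

lemma (in graph) co_duplicates_iff:
  "co_duplicates G u v \<longleftrightarrow>
    u \<noteq> v \<and> u \<rightarrow>\<^bsub>G\<^esub> v \<and> {w. u \<rightarrow>\<^bsub>G\<^esub> w} - {v} = {w. v \<rightarrow>\<^bsub>G\<^esub> w} - {u}"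
proof -
  have sym: "x \<rightarrow>\<^bsub>G\<^esub> y \<Longrightarrow> y \<rightarrow>\<^bsub>G\<^esub> x" for x y
    using sym_arcs by (rule arcs_ends_symmetric)
  have loop: "\<not> x \<rightarrow>\<^bsub>G\<^esub> x" for x
    using adj_not_same by blast
  have "(u \<in> verts G \<and> w \<in> verts G \<and> u \<noteq> w \<and> \<not> u \<rightarrow>\<^bsub>G\<^esub> w \<longleftrightarrow>
         v \<in> verts G \<and> w \<in> verts G \<and> v \<noteq> w \<and> \<not> v \<rightarrow>\<^bsub>G\<^esub> w) \<longleftrightarrow>
        (u \<rightarrow>\<^bsub>G\<^esub> w \<and> w \<noteq> v \<longleftrightarrow> v \<rightarrow>\<^bsub>G\<^esub> w \<and> w \<noteq> u)" if "u \<rightarrow>\<^bsub>G\<^esub> v" for w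
    using that sym[OF that] loop[of u] loop[of v] adj_in_verts[OF that]
      adj_in_verts[of u w] adj_in_verts[of v w]
    by (cases "w = u"; cases "w = v") auto
  then show ?thesis
    unfolding co_duplicates_def duplicates_def complement_graph_def with_proj_simps
    using adj_in_verts[of u v] by (auto simp: set_eq_iff)
qed

definition twins :: "('a, 'b) pre_digraph \<Rightarrow> 'a \<Rightarrow> 'a \<Rightarrow> bool" where
  "twins G u v \<longleftrightarrow> duplicates G u v \<or> co_duplicates G u v"

text \<open>
  The list \<open>vs\<close> enumerates the vertices and so fixes the (0-based) order of rows and columns.
\<close>

definition adjacency_matrix :: "('a, 'b) pre_digraph \<Rightarrow> 'a list \<Rightarrow> real mat" where
  "adjacency_matrix G vs =
    mat (length vs) (length vs) (\<lambda>(i, j). if vs ! i \<rightarrow>\<^bsub>G\<^esub> vs ! j then 1 else 0)"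

text \<open>
  \<^term>\<open>char_poly_matrix A\<close> is the matrix \<open>\<lambda>I - A\<close> over the polynomial ring in \<open>\<lambda>\<close>, and
  \<^term>\<open>char_poly A\<close> is its determinant. Rational functions are the elements of
  \<^typ>\<open>real poly fract\<close>, and \<^const>\<open>to_fract\<close> embeds the polynomials into them.
\<close>

end

theory Submission
  imports Defs
begin

text \<open>
  For twins, rows \<open>\<ell>\<close> and \<open>k\<close> of \<open>M = \<lambda>I - A\<close> differ only in columns \<open>\<ell>\<close> and \<open>k\<close>, by
  \<open>\<plusminus>(\<lambda> + a)\<close> with \<open>a = a\<^sub>\<ell>\<^sub>k\<close>. Multiplying the difference of these rows by column \<open>\<ell>\<close> of
  \<open>adj M\<close> and using \<open>M \<cdot> adj M = det M \<cdot> I\<close> gives \<open>(\<lambda> + a)((adj M)\<^sub>\<ell>\<^sub>\<ell> - (adj M)\<^sub>k\<^sub>\<ell>) = det M\<close>.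
  The diagonal cofactor \<open>(adj M)\<^sub>\<ell>\<^sub>\<ell>\<close> is the characteristic polynomial of the vertex-deleted graph,
  and \<open>adj M\<close> is symmetric.
\<close>

lemma det_eq_if_rows_agree_off_two_columns:
  fixes M :: "'a :: comm_ring_1 mat"
  assumes M: "M \<in> carrier_mat n n" and l: "l < n" and k: "k < n" and "l \<noteq> k"
    and rows: "\<And>j. j < n \<Longrightarrow> j \<noteq> l \<Longrightarrow> j \<noteq> k \<Longrightarrow> M $$ (l, j) = M $$ (k, j)"
    and l_entry: "M $$ (l, l) - M $$ (k, l) = c" and k_entry: "M $$ (l, k) - M $$ (k, k) = - c"
  shows "det M = c * (adj_mat M $$ (l, l) - adj_mat M $$ (k, l))"
proof -
  have adj: "adj_mat M \<in> carrier_mat n n" and prod: "M * adj_mat M = det M \<cdot>\<^sub>m 1\<^sub>m n"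
    using adj_mat[OF M] by auto
  have entry: "(\<Sum>j<n. M $$ (i, j) * adj_mat M $$ (j, l)) = (if i = l then det M else 0)" if "i < n" for i
    using arg_cong[OF prod, of "\<lambda>B. B $$ (i, l)"] that l M adj
    by (auto simp: scalar_prod_def atLeast0LessThan)
  \<comment> \<open>Row \<open>l\<close> times column \<open>l\<close> of the adjugate gives
    \<open>det M\<close>; row \<open>k\<close> times the same column gives 0 because
    \<open>l \<noteq> k\<close>.\<close>
  have "det M = (\<Sum>j<n. (M $$ (l, j) - M $$ (k, j)) * adj_mat M $$ (j, l))"
    using entry[OF l] entry[OF k] \<open>l \<noteq> k\<close> by (simp add: left_diff_distrib sum_subtractf)
  also have "\<dots> = (\<Sum>j\<in>{l, k}. (M $$ (l, j) - M $$ (k, j)) * adj_mat M $$ (j, l))"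
    using l k rows by (intro sum.mono_neutral_right) auto
  also have "\<dots> = c * (adj_mat M $$ (l, l) - adj_mat M $$ (k, l))"
    using \<open>l \<noteq> k\<close> by (simp add: l_entry k_entry right_diff_distrib)
  finally show ?thesis .
qed

lemma mat_delete_transpose:
  "mat_delete M\<^sup>T i j = (mat_delete M j i)\<^sup>T"
  if "i < dim_col M" "j < dim_row M"
  using that by (intro eq_matI) (auto simp: mat_delete_def)

text \<open>Transposing swaps the deleted row and column but changes neither the minor's determinant
  nor its sign. For symmetric \<open>M\<close> this exchanges the entries at \<open>(k, l)\<close>
  and \<open>(l, k)\<close>.\<close>

lemma adj_mat_transpose:
  fixes M :: "'a :: comm_ring_1 mat"
  assumes M: "M \<in> carrier_mat n n"
  shows "adj_mat M\<^sup>T = (adj_mat M)\<^sup>T"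
proof (rule eq_matI)
  fix i j assume "i < dim_row ((adj_mat M)\<^sup>T)" "j < dim_col ((adj_mat M)\<^sup>T)"
  then have "i < n" "j < n" using adj_mat(1)[OF M] by auto
  then show "adj_mat M\<^sup>T $$ (i, j) = (adj_mat M)\<^sup>T $$ (i, j)"
    using M det_transpose[OF mat_delete_carrier[OF M]]
    by (simp add: adj_mat_def cofactor_def mat_delete_transpose add.commute)
qed (auto simp: adj_mat_def)

text \<open>Since the deleted row and column have the same index, diagonal positions stay diagonal
  and keep their \<lambda>.\<close>

lemma char_poly_matrix_delete:
  assumes "A \<in> carrier_mat n n" "i < n"
  shows "mat_delete (char_poly_matrix A) i i = char_poly_matrix (mat_delete A i i)"
  using assms by (intro eq_matI) (auto simp: mat_delete_def char_poly_matrix_def)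

lemma adj_mat_char_poly_diag:
  assumes "A \<in> carrier_mat n n" "i < n"
  shows "adj_mat (char_poly_matrix A) $$ (i, i) = char_poly (mat_delete A i i)"
proof -
  have "char_poly_matrix A \<in> carrier_mat n n"
    using assms by simp
  then show ?thesis
    using assms(2)
    by (simp add: adj_mat_def cofactor_def char_poly_def char_poly_matrix_delete[OF assms])
qed

text \<open>Distinctness makes the first occurrence of \<open>xs ! l\<close> the one at position
  \<open>l\<close>. The resulting index shift is the one \<open>mat_delete\<close> uses, so deleting
  a vertex needs no reordering of rows.\<close>

lemma nth_remove1:
  assumes "distinct xs" "l < length xs" "i < length xs - 1"
  shows "remove1 (xs ! l) xs ! i = xs ! (if i < l then i else Suc i)"
  using assms
proof (induction xs arbitrary: l i)
  case (Cons x xs)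
  then show ?case
    by (cases l; cases i) (auto simp: nth_Cons')
qed simp

lemma dominates_del_vert:
  "u \<rightarrow>\<^bsub>pre_digraph.del_vert G x\<^esub> v \<longleftrightarrow> u \<rightarrow>\<^bsub>G\<^esub> v \<and> u \<noteq> x \<and> v \<noteq> x"
  by (auto simp: arcs_ends_def arc_to_ends_def pre_digraph.del_vert_simps)

lemma adjacency_matrix_del_vert:
  assumes "distinct vs" "l < length vs"
  shows "adjacency_matrix (pre_digraph.del_vert G (vs ! l)) (remove1 (vs ! l) vs) =
    mat_delete (adjacency_matrix G vs) l l"
  using assms
  by (intro eq_matI)
    (auto simp: adjacency_matrix_def mat_delete_def length_remove1 nth_remove1 dominates_del_vert
      nth_eq_iff_index_eq)

text \<open>The two kinds of twins differ only in whether \<open>u\<close> and \<open>v\<close> are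
  adjacent, so away from them both definitions say the same.\<close>

lemma (in graph) twins_dominates_iff:
  assumes "twins G u v" "w \<noteq> u" "w \<noteq> v"
  shows "u \<rightarrow>\<^bsub>G\<^esub> w \<longleftrightarrow> v \<rightarrow>\<^bsub>G\<^esub> w"
  using assms by (auto simp: twins_def duplicates_def co_duplicates_iff set_eq_iff)

theorem corollary14:
  fixes G :: "('a, 'b) pre_digraph" and vs :: "'a list" and l k :: nat
  assumes "graph G"
    and "Digraph_Component.connected G"
    and "distinct vs" and "set vs = verts G"
    and "l < length vs" and "k < length vs" and "l \<noteq> k"
    and "twins G (vs ! l) (vs ! k)"
  shows
    "let A = adjacency_matrix G vs;
         A' = adjacency_matrix (pre_digraph.del_vert G (vs ! l)) (remove1 (vs ! l) vs);
         h = adj_mat (char_poly_matrix A) $$ (l, k)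
     in to_fract (char_poly A') =
          to_fract (char_poly A) / to_fract [:A $$ (l, k), 1:] + to_fract h"
proof -
  interpret graph G by fact
  define A where "A = adjacency_matrix G vs"
  define n where "n = length vs"
  define M where "M = char_poly_matrix A"
  have sym: "x \<rightarrow>\<^bsub>G\<^esub> y \<longleftrightarrow> y \<rightarrow>\<^bsub>G\<^esub> x" for x y
    using sym_arcs arcs_ends_symmetric by metis
  have loop: "\<not> x \<rightarrow>\<^bsub>G\<^esub> x" for x
    using adj_not_same by blast
  have l: "l < n" and k: "k < n"
    using assms by (simp_all add: n_def)
  have A: "A \<in> carrier_mat n n"
    by (simp add: A_def n_def adjacency_matrix_def)
  have M: "M \<in> carrier_mat n n"
    using A by (simp add: M_def)
  have A_entry: "A $$ (i, j) = (if vs ! i \<rightarrow>\<^bsub>G\<^esub> vs ! j then 1 else 0)" if "i < n" "j < n" for i j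
    using that by (simp add: A_def n_def adjacency_matrix_def)
  have M_entry: "M $$ (i, j) = (if i = j then [:0, 1:] else 0) - [:A $$ (i, j):]" if "i < n" "j < n" for i j
    using that A by (simp add: M_def char_poly_matrix_def)
  have "M\<^sup>T = M"
    using M by (intro eq_matI) (auto simp: M_entry A_entry sym)
  then have adj_sym: "adj_mat M $$ (k, l) = adj_mat M $$ (l, k)"
    using adj_mat_transpose[OF M] adj_mat(1)[OF M] l k by (metis carrier_matD index_transpose_mat(1))
  have "det M = [:A $$ (l, k), 1:] * (adj_mat M $$ (l, l) - adj_mat M $$ (k, l))"
  proof (rule det_eq_if_rows_agree_off_two_columns[OF M l k \<open>l \<noteq> k\<close>])
    fix j assume "j < n" "j \<noteq> l" "j \<noteq> k"
    moreover from this have "vs ! j \<noteq> vs ! l" "vs ! j \<noteq> vs ! k"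
      using assms by (auto simp: n_def nth_eq_iff_index_eq)
    ultimately show "M $$ (l, j) = M $$ (k, j)"
      using l k twins_dominates_iff[OF assms(8)] by (simp add: M_entry A_entry)
  \<comment> \<open>Without loops both diagonal entries are \<lambda>, and by symmetry both mixed
    entries are -a, so the differences are \<lambda> + a and -(\<lambda> + a).\<close>
  qed (use l k \<open>l \<noteq> k\<close> in \<open>auto simp: M_entry A_entry loop sym\<close>)
  then have "char_poly A = [:A $$ (l, k), 1:] *
      (char_poly (mat_delete A l l) - adj_mat M $$ (l, k))"
    using adj_mat_char_poly_diag[OF A l] adj_sym by (simp add: char_poly_def M_def)
  \<comment> \<open>The divisor has leading coefficient 1, hence is nonzero. Keeping the product
    unexpanded lets it cancel.\<close>
  then have "to_fract (char_poly A) / to_fract [:A $$ (l, k), 1:] =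
      to_fract (char_poly (mat_delete A l l)) - to_fract (adj_mat M $$ (l, k))"
    by (simp del: mult_pCons_left)
  then show ?thesis
    using adjacency_matrix_del_vert[OF assms(3,5), of G]
    by (simp add: Let_def A_def M_def)
qed

end
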